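(* Let $k$ be a field, let $a_1,\dots,a_v$ ($v>0$) be positive integers with $\operatorname{GCD}(a_1,\dots,a_v)=1$, let $H=\langle a_1,\dots,a_v\rangle$ and assume $1\notin H$. Let $R=k[H]=k[t^{a_1},\dots,t^{a_v}]\subseteq k[t]$ and let $M=(1-t^{a_i}\mid 1\le i\le v)$, an ideal of $R$. Then $$M=(1-t^c\mid c\in H)=(1-t^a,\,1-t^b)$$ for all $a,b\in H$ with $a>0$, $b>0$ and $\operatorname{GCD}(a,b)=1$.
   Context: $\langle a_1,\dots,a_v\rangle=\{\sum_{i=1}^v c_ia_i\mid 0\le c_i\in\mathbb Z\}$ is the numerical semigroup generated by the $a_i$. All ideals $(\,\cdots)$ are ideals of $R$ generated by the listed elements. *)

theory Defs
  imports "HOL-Algebra.Algebra" "HOL-Algebra.Algebraic_Closure_Type"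
begin

definition semigroup_gen :: "nat \<Rightarrow> (nat \<Rightarrow> nat) \<Rightarrow> nat set" where
  "semigroup_gen v a = {\<Sum>i = 1..v. c i * a i | c :: nat \<Rightarrow> nat. True}"

text \<open>
  The semigroup ring \<open>k[H]\<close> inside \<open>k[t]\<close>: a polynomial is a \<open>k\<close>-linear combination of the
  powers \<open>t\<^sup>h\<close> with \<open>h \<in> H\<close> iff its support lies in \<open>H\<close>. It is a ring record, so that
  \<open>Idl\<close> with this ring as index generates ideals of \<open>k[H]\<close>, not of \<open>k[t]\<close>.
\<close>

definition semigroup_ring :: "nat set \<Rightarrow> 'k::field poly ring" where
  "semigroup_ring H =
     ring_of_type_algebra\<lparr>carrier := {p. \<forall>n. Polynomial.coeff p n \<noteq> 0 \<longrightarrow> n \<in> H}\<rparr>"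

lemma poly_ring_simps:
  "carrier (ring_of_type_algebra :: 'k::field poly ring) = UNIV"
  "\<one>\<^bsub>(ring_of_type_algebra :: 'k poly ring)\<^esub> = 1"
  "\<zero>\<^bsub>(ring_of_type_algebra :: 'k poly ring)\<^esub> = 0"
  "p \<otimes>\<^bsub>(ring_of_type_algebra :: 'k poly ring)\<^esub> q = p * q"
  "p \<oplus>\<^bsub>(ring_of_type_algebra :: 'k poly ring)\<^esub> q = p + q"
  by (auto simp: ring_of_type_algebra_def)

lemma poly_ring_a_inv: "\<ominus>\<^bsub>(ring_of_type_algebra :: 'k::field poly ring)\<^esub> p = - p"
proof -
  interpret ring "ring_of_type_algebra :: 'k poly ring" by (rule ring_from_type_algebra)
  show ?thesis by (rule minus_equality) (auto simp: poly_ring_simps)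
qed

lemma semigroup_gen_0: "0 \<in> semigroup_gen v a"
  unfolding semigroup_gen_def by (auto intro!: exI[of _ "\<lambda>_. 0"])

lemma semigroup_gen_add:
  assumes "m \<in> semigroup_gen v a" "n \<in> semigroup_gen v a"
  shows "m + n \<in> semigroup_gen v a"
proof -
  obtain c d where "m = (\<Sum>i = 1..v. c i * a i)" "n = (\<Sum>i = 1..v. d i * a i)"
    using assms unfolding semigroup_gen_def by auto
  hence "m + n = (\<Sum>i = 1..v. (c i + d i) * a i)"
    by (simp add: sum.distrib algebra_simps)
  thus ?thesis unfolding semigroup_gen_def by (intro CollectI exI[of _ "\<lambda>i. c i + d i"]) simp
qed

lemma semigroup_gen_incl:
  assumes "i \<in> {1..v}"
  shows "a i \<in> semigroup_gen v a"
proof -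
  have "a i = (\<Sum>j = 1..v. (if j = i then 1 else 0) * a j)"
    using assms by (subst sum.remove[of _ i]) auto
  thus ?thesis unfolding semigroup_gen_def by (intro CollectI exI) simp
qed

lemma semigroup_ring_subring:
  assumes "0 \<in> H" "\<And>m n. m \<in> H \<Longrightarrow> n \<in> H \<Longrightarrow> m + n \<in> H"
  shows "subring (carrier (semigroup_ring H)) (ring_of_type_algebra :: 'k::field poly ring)"
proof -
  interpret ring "ring_of_type_algebra :: 'k poly ring" by (rule ring_from_type_algebra)
  show ?thesis
  proof (rule subringI, goal_cases)
    case (4 p q)
    show ?case
    proof (clarsimp simp: semigroup_ring_def poly_ring_simps)
      fix n assume "Polynomial.coeff (p * q) n \<noteq> 0"
      then obtain i where "i \<le> n" "Polynomial.coeff p i * Polynomial.coeff q (n - i) \<noteq> 0"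
        unfolding coeff_mult by (metis (no_types, lifting) atMost_iff sum.neutral)
      with 4 assms(2)[of i "n - i"] show "n \<in> H" by (auto simp: semigroup_ring_def)
    qed
  next
    case (5 p q)
    thus ?case by (auto simp: semigroup_ring_def poly_ring_simps) (metis add_0)
  qed (use assms in \<open>auto simp: semigroup_ring_def poly_ring_simps poly_ring_a_inv\<close>)
qed

text \<open>The other description of the ring, \<open>k[t ^ a 1, \<dots>, t ^ a v]\<close>:\<close>

lemma semigroup_ring_eq_generate_ring:
  "carrier (semigroup_ring (semigroup_gen v a)) =
     generate_ring (ring_of_type_algebra :: 'k::field poly ring)
       (range (\<lambda>c. [:c:]) \<union> (\<lambda>i. Polynomial.monom 1 (a i)) ` {1..v})"
  (is "_ = generate_ring ?P ?G")
proof
  interpret ring ?P by (rule ring_from_type_algebra)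
  have one: "1 \<in> generate_ring ?P ?G"
    using generate_ring.one[of ?P ?G] by (simp add: poly_ring_simps)
  have mult: "p * q \<in> generate_ring ?P ?G"
    if "p \<in> generate_ring ?P ?G" "q \<in> generate_ring ?P ?G" for p q
    using generate_ring.eng_mult[OF that] by (simp add: poly_ring_simps)
  have add: "p + q \<in> generate_ring ?P ?G"
    if "p \<in> generate_ring ?P ?G" "q \<in> generate_ring ?P ?G" for p q
    using generate_ring.eng_add[OF that] by (simp add: poly_ring_simps)
  have zero: "0 \<in> generate_ring ?P ?G"
    using zero_in_generate[of ?G] by (simp add: poly_ring_simps)
  have power: "p ^ n \<in> generate_ring ?P ?G" if "p \<in> generate_ring ?P ?G" for p n
    by (induction n) (simp_all only: power_0 power_Suc one mult that)
  have prod: "prod f A \<in> generate_ring ?P ?G" if "\<And>i. i \<in> A \<Longrightarrow> f i \<in> generate_ring ?P ?G"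
    for f :: "nat \<Rightarrow> 'k poly" and A
    using that by (induction A rule: infinite_finite_induct) (simp_all only: prod.infinite prod.empty prod.insert one mult insert_iff simp_thms not_False_eq_True)
  have sum: "sum f A \<in> generate_ring ?P ?G" if "\<And>i. i \<in> A \<Longrightarrow> f i \<in> generate_ring ?P ?G"
    for f :: "nat \<Rightarrow> 'k poly" and A
    using that by (induction A rule: infinite_finite_induct) (simp_all only: sum.infinite sum.empty sum.insert zero add insert_iff simp_thms)
  have monom_prod: "Polynomial.monom 1 (sum f A) = (\<Prod>i\<in>A. Polynomial.monom (1 :: 'k) (f i))"
    if "finite A"
    for f :: "nat \<Rightarrow> nat" and A
    using that
  proof (induction A rule: finite_induct)
    case (insert x A)
    have "Polynomial.monom (1 :: 'k) (f x + sum f A) =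
            Polynomial.monom 1 (f x) * Polynomial.monom 1 (sum f A)"
      by (simp add: mult_monom)
    with insert show ?case by simp
  qed simp
  have monom: "Polynomial.monom 1 h \<in> generate_ring ?P ?G" if h_mem: "h \<in> semigroup_gen v a" for h
  proof -
    obtain c where h: "h = (\<Sum>i = 1..v. c i * a i)"
      using h_mem unfolding semigroup_gen_def by blast
    have "Polynomial.monom (1 :: 'k) h = (\<Prod>i = 1..v. Polynomial.monom 1 (a i) ^ c i)"
      by (simp add: h monom_prod monom_power mult.commute)
    also have "\<dots> \<in> generate_ring ?P ?G"
      by (intro prod power generate_ring.incl) auto
    finally show ?thesis .
  qed
  show "carrier (semigroup_ring (semigroup_gen v a)) \<subseteq> generate_ring ?P ?G"
  proof
    fix p :: "'k poly" assume p: "p \<in> carrier (semigroup_ring (semigroup_gen v a))"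
    have "p = (\<Sum>i\<le>degree p. Polynomial.monom (Polynomial.coeff p i) i)"
      by (simp add: poly_as_sum_of_monoms)
    also have "\<dots> \<in> generate_ring ?P ?G"
    proof (rule sum)
      fix i
      show "Polynomial.monom (Polynomial.coeff p i) i \<in> generate_ring ?P ?G"
      proof (cases "Polynomial.coeff p i = 0")
        case True
        thus ?thesis using zero by simp
      next
        case False
        have "Polynomial.monom (Polynomial.coeff p i) i = [:Polynomial.coeff p i:] * Polynomial.monom 1 i"
          by (simp add: smult_monom)
        moreover have "[:Polynomial.coeff p i:] \<in> generate_ring ?P ?G" by (intro generate_ring.incl) auto
        moreover have "Polynomial.monom 1 i \<in> generate_ring ?P ?G"
          using p False by (intro monom) (auto simp: semigroup_ring_def)
        ultimately show ?thesis using mult by metis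
      qed
    qed
    finally show "p \<in> generate_ring ?P ?G" .
  qed
  show "generate_ring ?P ?G \<subseteq> carrier (semigroup_ring (semigroup_gen v a))"
  proof (rule generate_ring_min_subring1)
    show "subring (carrier (semigroup_ring (semigroup_gen v a))) ?P"
      by (intro semigroup_ring_subring semigroup_gen_0 semigroup_gen_add)
    show "?G \<subseteq> carrier (semigroup_ring (semigroup_gen v a))"
      by (auto simp: semigroup_ring_def coeff_pCons semigroup_gen_0 semigroup_gen_incl
               split: nat.splits if_splits)
  qed (simp add: poly_ring_simps)
qed

lemma semigroup_ring_cring:
  "cring (semigroup_ring (semigroup_gen v a) :: 'k::field poly ring)"
proof -
  interpret P: cring "ring_of_type_algebra :: 'k poly ring" by (rule cring_from_type_algebra)
  let ?C = "carrier (semigroup_ring (semigroup_gen v a) :: 'k poly ring)"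
  have "subring ?C (ring_of_type_algebra :: 'k poly ring)"
    by (intro semigroup_ring_subring semigroup_gen_0 semigroup_gen_add)
  from P.subring_is_ring[OF this]
  have "ring (semigroup_ring (semigroup_gen v a) :: 'k poly ring)"
    by (simp add: semigroup_ring_def)
  then interpret ring "semigroup_ring (semigroup_gen v a) :: 'k poly ring" .
  show ?thesis
    by unfold_locales (auto simp: semigroup_ring_def poly_ring_simps mult.commute)
qed

end

theory Submission
  imports Defs
begin

text \<open>
  For an ideal \<open>I\<close> of \<open>k[H]\<close>, the set of all \<open>c \<in> H\<close> with \<open>1 - t ^ c \<in> I\<close> is a submonoid of \<open>H\<close>
  that is cancellative in \<open>H\<close>: from \<open>1 - t ^ d = (1 - t ^ (c + d)) - t ^ d * (1 - t ^ c)\<close> it contains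
  \<open>d\<close> whenever it contains \<open>c\<close> and \<open>c + d\<close>. If it contains coprime positive \<open>x\<close> and \<open>y\<close>, Bezout
  gives \<open>y * p = x * q + d\<close> for every \<open>d \<in> H\<close>, so it is all of \<open>H\<close>.
\<close>

lemma semigroup_ring_ops [simp]:
  "p \<otimes>\<^bsub>semigroup_ring H\<^esub> q = p * q"
  "p \<oplus>\<^bsub>semigroup_ring H\<^esub> q = p + q"
  "\<zero>\<^bsub>semigroup_ring H\<^esub> = 0"
  by (simp_all add: semigroup_ring_def poly_ring_simps)

lemma monom_mem_semigroup_ring:
  "c \<in> H \<Longrightarrow> Polynomial.monom b c \<in> carrier (semigroup_ring H)"
  by (auto simp: semigroup_ring_def)

text \<open>The constant term puts 0 into the support, hence the assumption
  \<open>0 \<in> H\<close>.\<close>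

lemma one_minus_monom_mem_semigroup_ring:
  assumes "0 \<in> H" "c \<in> H"
  shows "1 - Polynomial.monom 1 c \<in> carrier (semigroup_ring H)"
  using assms by (auto simp: semigroup_ring_def split: if_splits)

context
  fixes H :: "nat set" and I :: "'k::field poly set"
  assumes ideal: "ideal I (semigroup_ring H)"
begin

text \<open>Both the addition and the cancellation of exponents below are instances of this
  combination, with a monomial of k[H] as \<open>r\<close>.\<close>

lemma ideal_semigroup_ring_combine:
  assumes "p \<in> I" "r \<in> carrier (semigroup_ring H)" "q \<in> I"
  shows "p + r * q \<in> I"
  using additive_subgroup.a_closed[OF ideal.axioms(1)[OF ideal] assms(1)
      ideal.I_l_closed[OF ideal assms(3,2)]] by simp

lemma one_minus_monom_zero: "1 - Polynomial.monom 1 0 \<in> I"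
  using additive_subgroup.zero_closed[OF ideal.axioms(1)[OF ideal]] by simp

lemma one_minus_monom_add:
  assumes "c \<in> H" "1 - Polynomial.monom 1 c \<in> I" "1 - Polynomial.monom 1 d \<in> I"
  shows "1 - Polynomial.monom 1 (c + d) \<in> I"
proof -
  have eq: "1 - Polynomial.monom 1 (c + d) =
      (1 - Polynomial.monom 1 c) + Polynomial.monom 1 c * (1 - Polynomial.monom (1::'k) d)"
    by (simp add: algebra_simps mult_monom)
  show ?thesis unfolding eq
    by (rule ideal_semigroup_ring_combine[OF assms(2) monom_mem_semigroup_ring[OF assms(1)] assms(3)])
qed

lemma one_minus_monom_cancel:
  assumes "d \<in> H" "1 - Polynomial.monom 1 c \<in> I" "1 - Polynomial.monom 1 (c + d) \<in> I"
  shows "1 - Polynomial.monom 1 d \<in> I"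
proof -
  \<comment> \<open>The minus sign is moved into the coefficient of the monomial, so that the
    identity has the shape \<open>p + r * q\<close>.\<close>
  have eq: "1 - Polynomial.monom 1 d =
      (1 - Polynomial.monom 1 (c + d)) + Polynomial.monom (- 1) d * (1 - Polynomial.monom (1::'k) c)"
    by (simp add: algebra_simps mult_monom flip: minus_monom)
  show ?thesis unfolding eq
    by (rule ideal_semigroup_ring_combine[OF assms(3) monom_mem_semigroup_ring[OF assms(1)] assms(2)])
qed

text \<open>Each induction step adds \<open>c\<close> on the left, so the multiplier is always t^c
  and \<open>c \<in> H\<close> is enough, whether or not \<open>H\<close> is closed under
  addition.\<close>

lemma one_minus_monom_mult:
  assumes "c \<in> H" "1 - Polynomial.monom 1 c \<in> I"
  shows "1 - Polynomial.monom 1 (n * c) \<in> I"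
proof (induction n)
  case 0
  show ?case using one_minus_monom_zero by simp
next
  case (Suc n)
  with one_minus_monom_add[OF assms] show ?case by simp
qed

lemma one_minus_monom_coprime:
  assumes "x \<in> H" "y \<in> H" "y > 0" "gcd x y = 1" "d \<in> H"
    and "1 - Polynomial.monom 1 x \<in> I" "1 - Polynomial.monom 1 y \<in> I"
  shows "1 - Polynomial.monom 1 d \<in> I"
proof -
  \<comment> \<open>Over the naturals Bezout is stated without subtraction; the side without the gcd
    belongs to \<open>y\<close>, which has to be nonzero.\<close>
  obtain p q where "y * p = x * q + 1"
    using bezout_nat[of y x] assms(3,4) by (auto simp: gcd.commute)
  hence "y * p * d = (x * q + 1) * d" by simp
  \<comment> \<open>A multiple of \<open>x\<close> plus \<open>d\<close> is a multiple of
    \<open>y\<close>, so cancelling the multiple of \<open>x\<close> leaves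
    \<open>d\<close>.\<close>
  hence eq: "(d * q) * x + d = (d * p) * y" by (simp add: algebra_simps)
  show ?thesis
    using one_minus_monom_cancel[of d "(d * q) * x", OF assms(5) one_minus_monom_mult[OF assms(1,6)]]
      one_minus_monom_mult[OF assms(2,7), of "d * p"] unfolding eq by blast
qed

end

lemma one_minus_monom_semigroup_gen:
  fixes I :: "'k::field poly set"
  assumes I: "ideal I (semigroup_ring (semigroup_gen v a))"
    and gens: "\<And>i. i \<in> {1..v} \<Longrightarrow> 1 - Polynomial.monom 1 (a i) \<in> I"
    and d: "d \<in> semigroup_gen v a"
  shows "1 - Polynomial.monom 1 d \<in> I"
proof -
  obtain c where d_eq: "d = (\<Sum>i = 1..v. c i * a i)"
    using d unfolding semigroup_gen_def by blast
  \<comment> \<open>In the sum below, t^(c i * a i) is the multiplier when the summand for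
    \<open>i\<close> is added, so it must lie in k[H].\<close>
  have mem: "n * a i \<in> semigroup_gen v a" if "i \<in> {1..v}" for i n
    by (induction n) (auto intro: semigroup_gen_0 semigroup_gen_add semigroup_gen_incl that)
  have "1 - Polynomial.monom 1 (\<Sum>i\<in>A. c i * a i) \<in> I" if "finite A" "A \<subseteq> {1..v}" for A
    using that
  proof (induction A rule: finite_induct)
    case empty
    show ?case using one_minus_monom_zero[OF I] by simp
  next
    case (insert i A)
    hence i: "i \<in> {1..v}" by simp
    with insert show ?case
      using one_minus_monom_add[OF I mem[OF i] one_minus_monom_mult[OF I semigroup_gen_incl[OF i] gens[OF i]]]
      by simp
  qed
  thus ?thesis unfolding d_eq by simp
qed

theorem theorem4p2:
  fixes v :: nat and a :: "nat \<Rightarrow> nat" and H :: "nat set"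
    and R :: "'k::field poly ring" and M :: "'k poly set"
  assumes v_pos: "v > 0"
    and a_pos: "\<forall>i\<in>{1..v}. a i > 0"
    and a_Gcd: "Gcd (a ` {1..v}) = 1"
    and H_eq: "H = semigroup_gen v a"
    and one_notin: "1 \<notin> H"
    and R_eq: "R = semigroup_ring H"
    and M_eq: "M = Idl\<^bsub>R\<^esub> {1 - Polynomial.monom 1 (a i) | i. i \<in> {1..v}}"
  shows "M = Idl\<^bsub>R\<^esub> {1 - Polynomial.monom 1 c | c. c \<in> H} \<and>
    (\<forall>x\<in>H. \<forall>y\<in>H. x > 0 \<longrightarrow> y > 0 \<longrightarrow> gcd x y = 1 \<longrightarrow>
       M = Idl\<^bsub>R\<^esub> {1 - Polynomial.monom 1 x, 1 - Polynomial.monom 1 y})"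
proof -
  interpret cring R unfolding R_eq H_eq by (rule semigroup_ring_cring)
  let ?m = "\<lambda>c. 1 - Polynomial.monom (1::'k) c"
  have zero: "0 \<in> H" unfolding H_eq by (rule semigroup_gen_0)
  have carrier: "?m c \<in> carrier R" if "c \<in> H" for c
    unfolding R_eq using zero that by (rule one_minus_monom_mem_semigroup_ring)
  have a_mem: "a i \<in> H" if "i \<in> {1..v}" for i
    unfolding H_eq using that by (rule semigroup_gen_incl)
  \<comment> \<open>The ideal of all \<open>?m c\<close> with c in \<open>H\<close> is the common
    value to which every other ideal is compared: \<open>S\<close> will be the set of the
    \<open>a i\<close>, and then \<open>{x, y}\<close>. Only the inclusion supplied by
    \<open>gen\<close> has content.\<close>
  have eq: "Idl\<^bsub>R\<^esub> (?m ` S) = Idl\<^bsub>R\<^esub> (?m ` H)"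
    if S: "S \<subseteq> H" and gen: "\<And>d. d \<in> H \<Longrightarrow> ?m d \<in> Idl\<^bsub>R\<^esub> (?m ` S)" for S
  proof
    have carriers: "?m ` S \<subseteq> carrier R" "?m ` H \<subseteq> carrier R" using S carrier by auto
    show "Idl\<^bsub>R\<^esub> (?m ` S) \<subseteq> Idl\<^bsub>R\<^esub> (?m ` H)"
      using genideal_ideal[OF carriers(2)] genideal_self[OF carriers(2)] S
      by (intro genideal_minimal) auto
    show "Idl\<^bsub>R\<^esub> (?m ` H) \<subseteq> Idl\<^bsub>R\<^esub> (?m ` S)"
      using genideal_ideal[OF carriers(1)] gen by (intro genideal_minimal) auto
  qed
  have ideal_self: "ideal (Idl\<^bsub>R\<^esub> (?m ` S)) R" "?m ` S \<subseteq> Idl\<^bsub>R\<^esub> (?m ` S)" if "S \<subseteq> H" for S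
  proof -
    have "?m ` S \<subseteq> carrier R" using that carrier by auto
    thus "ideal (Idl\<^bsub>R\<^esub> (?m ` S)) R" "?m ` S \<subseteq> Idl\<^bsub>R\<^esub> (?m ` S)"
      by (rule genideal_ideal, rule genideal_self)
  qed
  have ideal_R: "ideal I (semigroup_ring H)" if "ideal I R" for I
    using that unfolding R_eq .
  have "Idl\<^bsub>R\<^esub> (?m ` a ` {1..v}) = Idl\<^bsub>R\<^esub> (?m ` H)"
  proof (rule eq)
    show sub: "a ` {1..v} \<subseteq> H" using a_mem by auto
    show "?m d \<in> Idl\<^bsub>R\<^esub> (?m ` a ` {1..v})" if "d \<in> H" for d
    proof (rule one_minus_monom_semigroup_gen)
      show "ideal (Idl\<^bsub>R\<^esub> (?m ` a ` {1..v})) (semigroup_ring (semigroup_gen v a))"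
        using ideal_R[OF ideal_self(1)[OF sub]] unfolding H_eq .
      show "?m (a i) \<in> Idl\<^bsub>R\<^esub> (?m ` a ` {1..v})" if "i \<in> {1..v}" for i
        using ideal_self(2)[OF sub] that by blast
    qed (use that H_eq in simp)
  qed
  moreover have "{?m (a i) | i. i \<in> {1..v}} = ?m ` a ` {1..v}" by auto
  ultimately have M: "M = Idl\<^bsub>R\<^esub> (?m ` H)" unfolding M_eq by simp
  have "M = Idl\<^bsub>R\<^esub> {?m x, ?m y}"
    if xy: "x \<in> H" "y \<in> H" and coprime: "y > 0" "gcd x y = 1" for x y
  proof -
    have "Idl\<^bsub>R\<^esub> (?m ` {x, y}) = Idl\<^bsub>R\<^esub> (?m ` H)"
    proof (rule eq)
      show sub: "{x, y} \<subseteq> H" using xy by simp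
      show "?m d \<in> Idl\<^bsub>R\<^esub> (?m ` {x, y})" if "d \<in> H" for d
        by (rule one_minus_monom_coprime[OF ideal_R[OF ideal_self(1)[OF sub]] xy coprime that])
          (use ideal_self(2)[OF sub] in auto)
    qed
    thus ?thesis unfolding M by simp
  qed
  moreover have "{?m c | c. c \<in> H} = ?m ` H" by auto
  ultimately show ?thesis using M by auto
qed

end
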